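(* The number of $2\times 2$ involutory MDS matrices over the finite field $\mathbb{F}_{2^r}$ is $(2^r-1)(2^r-2)$.
   Context: A square matrix $M$ over a field is an MDS matrix if every square submatrix of $M$ (formed by any $i$ rows and any $i$ columns, $i\ge 1$, including $M$ itself) is nonsingular. A matrix $M$ of order $n$ is involutory if $M^2=I_n$. *)

theory Defs
  imports
    "Jordan_Normal_Form.Determinant"
    "Jordan_Normal_Form.DL_Submatrix"
    "HOL-Library.Cardinality"
begin

text \<open>Rows and columns are indexed from 0; \<open>submatrix M I J\<close> keeps the rows in \<open>I\<close> and the
  columns in \<open>J\<close>, in increasing order. The choice \<open>I = J = {..<dim_row M}\<close> gives \<open>M\<close> itself.\<close>

definition mds_mat :: "'a::field mat \<Rightarrow> bool" where
  "mds_mat M \<longleftrightarrow> square_mat M \<and>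
     (\<forall>I J. I \<subseteq> {..<dim_row M} \<longrightarrow> J \<subseteq> {..<dim_col M} \<longrightarrow> card I = card J \<longrightarrow> card I \<ge> 1 \<longrightarrow>
        det (submatrix M I J) \<noteq> 0)"

definition involutory_mat :: "'a::semiring_1 mat \<Rightarrow> bool" where
  "involutory_mat M \<longleftrightarrow> square_mat M \<and> M * M = 1\<^sub>m (dim_row M)"

end

theory Submission
  imports Defs "HOL-Number_Theory.Residues"
begin

text \<open>An involutory matrix is nonsingular, so an involutory \<open>2 \<times> 2\<close> matrix is MDS as soon as its
  entries \<open>a, b, c, d\<close> are nonzero. Over a field of characteristic 2 with \<open>b \<noteq> 0\<close>, the
  equation \<open>M\<^sup>2 = I\<close> means \<open>d = a\<close> and \<open>b c = 1 - a\<^sup>2\<close>; so \<open>M\<close> is determined by \<open>a\<close>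
  and \<open>b\<close>, and \<open>c \<noteq> 0\<close> means \<open>a\<^sup>2 \<noteq> 1\<close>, that is \<open>a \<noteq> 1\<close>.\<close>

text \<open>The characteristic divides the number of elements, so \<open>2 ^ r\<close> vanishes in
  the field; a field has no nonzero nilpotent elements.\<close>

lemma two_eq_0_of_CARD_power2:
  assumes "CARD('a::{field,finite}) = 2 ^ r"
  shows "(2::'a) = 0"
proof -
  have "of_nat CARD('a) = (0::'a)"
    using CHAR_dvd_CARD by (simp only: of_nat_eq_0_iff_char_dvd)
  then have "(2::'a) ^ r = 0"
    by (simp add: assms)
  then show ?thesis
    by simp
qed

lemma submatrix_singleton:
  assumes "i < dim_row A" "j < dim_col A"
  shows "submatrix A {i} {j} = mat 1 1 (\<lambda>_. A $$ (i, j))"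
proof -
  have *: "{k. k < dim_row A \<and> k \<in> {i}} = {i}" "{k. k < dim_col A \<and> k \<in> {j}} = {j}"
    using assms by auto
  have pick: "pick {k} 0 = k" for k
    by (simp add: Least_equality)
  show ?thesis
    unfolding submatrix_def * by (rule cong_mat) (auto simp add: pick simp del: pick.simps)
qed

lemma submatrix_full: "submatrix A {..<dim_row A} {..<dim_col A} = A"
proof -
  have pick: "pick {..<n} k = k" if "k < n" for n k :: nat
  proof -
    \<comment> \<open>An element of a set is picked at the index counting the smaller elements of
      that set; in an initial segment this count is \<open>k\<close> itself.\<close>
    have "{a \<in> {..<n}. a < k} = {..<k}"
      using that by auto
    then show ?thesis
      using pick_card_in_set[of k "{..<n}"] that by simp
  qed
  have *: "{i. i < n \<and> i \<in> {..<n}} = {..<n}" for n :: nat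
    by auto
  show ?thesis
    by (rule eq_matI) (simp_all add: submatrix_def * pick del: pick.simps)
qed

text \<open>Index sets inside \<open>{..<2}\<close> of equal positive size are either both
  singletons, which give the four entries, or both full, which gives \<open>M\<close>.\<close>

lemma mds_mat_2_iff:
  assumes M: "M \<in> carrier_mat 2 2"
  shows "mds_mat M \<longleftrightarrow> (\<forall>i<2. \<forall>j<2. M $$ (i, j) \<noteq> 0) \<and> det M \<noteq> 0"
proof -
  have dim: "dim_row M = 2" "dim_col M = 2"
    using M by auto
  have single: "det (submatrix M {i} {j}) = M $$ (i, j)" if "i < 2" "j < 2" for i j
    using that by (subst submatrix_singleton) (simp_all add: dim det_single)
  have full: "submatrix M {..<2} {..<2} = M"
    using submatrix_full[of M] by (simp add: dim)
  show ?thesis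
  proof (intro iffI conjI allI impI)
    fix i j :: nat
    assume "mds_mat M" "i < 2" "j < 2"
    then have "det (submatrix M {i} {j}) \<noteq> 0"
      by (simp add: mds_mat_def dim)
    then show "M $$ (i, j) \<noteq> 0"
      using single \<open>i < 2\<close> \<open>j < 2\<close> by simp
  next
    assume "mds_mat M"
    then have "det (submatrix M {..<2} {..<2}) \<noteq> 0"
      by (simp add: mds_mat_def dim)
    then show "det M \<noteq> 0"
      by (simp add: full)
  next
    assume *: "(\<forall>i<2. \<forall>j<2. M $$ (i, j) \<noteq> 0) \<and> det M \<noteq> 0"
    have "det (submatrix M I J) \<noteq> 0"
      if IJ: "I \<subseteq> {..<2}" "J \<subseteq> {..<2}" "card I = card J" "card I \<ge> 1" for I J
    proof (cases "card I = 1")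
      case True
      then obtain i j where "I = {i}" "J = {j}"
        using IJ(3) by (metis card_1_singletonE)
      then show ?thesis
        using * single IJ by simp
    next
      case False
      have "card I \<le> 2"
        using card_mono[OF _ IJ(1)] by simp
      then have "card I = 2"
        using False IJ(4) by simp
      then have "I = {..<2}" "J = {..<2}"
        using IJ card_subset_eq[of "{..<2}" I] card_subset_eq[of "{..<2}" J] by simp_all
      then show ?thesis
        using * full by simp
    qed
    then show "mds_mat M"
      using dim by (auto simp: mds_mat_def)
  qed
qed

text \<open>Taking determinants in \<open>M * M = 1\<close> gives a determinant whose square is 1,
  so no explicit formula for it is needed.\<close>

lemma det_involutory_mat:
  fixes M :: "'a::field mat"
  assumes "involutory_mat M"
  shows "det M \<noteq> 0"
proof -
  have M: "M \<in> carrier_mat (dim_row M) (dim_row M)" and "M * M = 1\<^sub>m (dim_row M)"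
    using assms by (auto simp: involutory_mat_def)
  then have "det M * det M = 1"
    using det_mult[OF M M] by (metis det_one)
  then show ?thesis
    by auto
qed

text \<open>Both off-diagonal entries of the square contain the trace as a factor. They are kept
  factored so that a nonzero off-diagonal entry of \<open>M\<close> can be cancelled, which forces
  the trace to vanish.\<close>

lemma involutory_mat_2_iff:
  fixes M :: "'a::comm_ring_1 mat"
  assumes M: "M \<in> carrier_mat 2 2"
  shows "involutory_mat M \<longleftrightarrow>
    M $$ (0, 0) * M $$ (0, 0) + M $$ (0, 1) * M $$ (1, 0) = 1 \<and>
    M $$ (0, 1) * (M $$ (0, 0) + M $$ (1, 1)) = 0 \<and>
    M $$ (1, 0) * (M $$ (0, 0) + M $$ (1, 1)) = 0 \<and>
    M $$ (1, 0) * M $$ (0, 1) + M $$ (1, 1) * M $$ (1, 1) = 1"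
proof -
  have prod: "(M * M) $$ (i, j) = M $$ (i, 0) * M $$ (0, j) + M $$ (i, 1) * M $$ (1, j)"
    if "i < 2" "j < 2" for i j
    using that M by (simp add: scalar_prod_def numeral_2_eq_2)
  have "M * M = 1\<^sub>m 2 \<longleftrightarrow> (\<forall>i<2. \<forall>j<2. (M * M) $$ (i, j) = 1\<^sub>m 2 $$ (i, j))"
    using M by (auto simp: mat_eq_iff)
  also have "\<dots> \<longleftrightarrow>
    (M * M) $$ (0, 0) = 1 \<and> (M * M) $$ (0, 1) = 0 \<and>
    (M * M) $$ (1, 0) = 0 \<and> (M * M) $$ (1, 1) = 1"
    by (auto simp: less_2_cases_iff)
  finally show ?thesis
    using M by (simp add: involutory_mat_def prod distrib_left mult.commute add.commute
        del: index_mult_mat)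
qed

theorem lemma7:
  fixes r :: nat
  assumes "CARD('a::{field,finite}) = 2 ^ r"
  shows "card {M :: 'a mat. M \<in> carrier_mat 2 2 \<and> involutory_mat M \<and> mds_mat M}
           = (2 ^ r - 1) * (2 ^ r - 2)"
proof -
  have two: "(2::'a) = 0"
    using two_eq_0_of_CARD_power2[OF assms] .
  have add_eq_0: "x + y = 0 \<longleftrightarrow> y = x" for x y :: 'a
  proof -
    have "x + x = 0"
      using two by (simp flip: mult_2)
    then show ?thesis
      by (metis add_left_cancel)
  qed
  \<comment> \<open>The two roots 1 and -1 of \<open>x * x = 1\<close> coincide in characteristic
    2.\<close>
  have square_eq_1: "x * x = 1 \<longleftrightarrow> x = 1" for x :: 'a
    using add_eq_0[of x 1] by (auto simp: square_eq_1_iff)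
  \<comment> \<open>The parameters are the top row; the lower left entry solves
    \<open>a * a + b * c = 1\<close> for \<open>c\<close>.\<close>
  define f :: "'a \<times> 'a \<Rightarrow> 'a mat" where
    "f = (\<lambda>(a, b). mat 2 2 (\<lambda>(i, j). if i = j then a else if i = 0 then b else (1 - a * a) / b))"
  define A :: "('a \<times> 'a) set" where "A = (UNIV - {0, 1}) \<times> (UNIV - {0})"
  have f_simps: "f (a, b) $$ (0, 0) = a" "f (a, b) $$ (0, 1) = b"
    "f (a, b) $$ (1, 0) = (1 - a * a) / b" "f (a, b) $$ (1, 1) = a"
    "f (a, b) \<in> carrier_mat 2 2" for a b
    by (auto simp: f_def)
  have "{M :: 'a mat. M \<in> carrier_mat 2 2 \<and> involutory_mat M \<and> mds_mat M} = f ` A"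
  proof (intro equalityI subsetI)
    fix M :: "'a mat"
    assume "M \<in> {M. M \<in> carrier_mat 2 2 \<and> involutory_mat M \<and> mds_mat M}"
    then have M: "M \<in> carrier_mat 2 2" and inv: "involutory_mat M" and mds: "mds_mat M"
      by auto
    have nz: "M $$ (0, 0) \<noteq> 0" "M $$ (0, 1) \<noteq> 0" "M $$ (1, 0) \<noteq> 0"
      using mds mds_mat_2_iff[OF M] by auto
    have eqs: "M $$ (0, 0) * M $$ (0, 0) + M $$ (0, 1) * M $$ (1, 0) = 1"
      "M $$ (1, 1) = M $$ (0, 0)"
      using inv nz involutory_mat_2_iff[OF M] by (auto simp: add_eq_0)
    have c: "M $$ (1, 0) = (1 - M $$ (0, 0) * M $$ (0, 0)) / M $$ (0, 1)"
      using eqs(1) nz(2) by (simp add: field_simps eq_diff_eq)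
    have "M = f (M $$ (0, 0), M $$ (0, 1))"
      using M eqs(2) c by (intro eq_matI) (auto simp: f_simps less_2_cases_iff f_def)
    moreover have "(M $$ (0, 0), M $$ (0, 1)) \<in> A"
      \<comment> \<open>If the corner entry were 1, then \<open>c\<close> would make the lower left
        entry 0, against \<open>nz\<close>.\<close>
      using nz c by (auto simp: A_def)
    ultimately show "M \<in> f ` A"
      by blast
  next
    fix M
    assume "M \<in> f ` A"
    then obtain a b where M: "M = f (a, b)" and ab: "a \<noteq> 0" "a \<noteq> 1" "b \<noteq> 0"
      by (auto simp: A_def)
    \<comment> \<open>This is the trace of \<open>f (a, b)\<close>, so the off-diagonal entries of
      its square vanish.\<close>
    have "a + a = 0"
      using add_eq_0 by blast
    then have inv: "involutory_mat (f (a, b))"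
      using ab by (simp only: involutory_mat_2_iff[OF f_simps(5)] f_simps) simp
    have "1 - a * a \<noteq> 0"
      using ab square_eq_1[of a] by auto
    then have "mds_mat (f (a, b))"
      using ab det_involutory_mat[OF inv]
      by (auto simp: mds_mat_2_iff[OF f_simps(5)] less_2_cases_iff f_simps[unfolded One_nat_def])
    then show "M \<in> {M. M \<in> carrier_mat 2 2 \<and> involutory_mat M \<and> mds_mat M}"
      using inv f_simps(5) M by simp
  qed
  moreover have "inj_on f A"
    \<comment> \<open>The pair is read off the top row of its image.\<close>
    by (rule inj_onI) (metis f_simps(1,2) surj_pair)
  moreover have "card A = (2 ^ r - 2) * (2 ^ r - 1)"
    \<comment> \<open>Since 0 and 1 are distinct, the first factor loses exactly two elements and
      the second one.\<close>
    by (simp add: A_def card_cartesian_product card_Diff_subset assms numeral_2_eq_2)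
  ultimately show ?thesis
    by (simp only: card_image mult.commute)
qed

end
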